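(* For any $0\le\phi\le1$ and any two permutations $\pi^*,\sigma^*$ on $[n]$, $$D_{\mathrm{TV}}\big(M(\phi,\pi^* ),M(\phi,\sigma^* )\big)\le 2(1-\phi)\,\|v_{\pi^*}-v_{\sigma^*}\|.$$
   Context: For a permutation $\pi$ on $[n]$, $\pi^{-1}(i)$ denotes the position of element $i$. The Kendall-tau distance $d_{\mathrm{KT}}(\pi,\sigma)$ is the number of pairs of elements whose relative order in $\pi$ differs from that in $\sigma$. The Mallows model $M(\phi,\pi^* )$ on $[n]$ is the distribution on permutations with $\Pr[\pi]=\phi^{d_{\mathrm{KT}}(\pi,\pi^* )}/\sum_{\pi'}\phi^{d_{\mathrm{KT}}(\pi',\pi^* )}$ (with $0^0=1$). The position vector is $v_\pi=(\pi^{-1}(1),\dots,\pi^{-1}(n))\in\mathbb R^n$; $\|\cdot\|$ is the Euclidean norm and $D_{\mathrm{TV}}$ is total variation distance. *)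

theory Defs
  imports "HOL-Probability.Probability" "HOL-Combinatorics.Permutations"
begin

text \<open>
  A permutation on \<open>[n]\<close> is a function \<open>\<pi>\<close> with \<open>\<pi> permutes {1..n}\<close>; \<open>\<pi> k\<close> is the element in
  position \<open>k\<close>, so \<open>inv \<pi> i\<close> is the position of element \<open>i\<close>.
\<close>

definition kendall_tau :: "nat \<Rightarrow> (nat \<Rightarrow> nat) \<Rightarrow> (nat \<Rightarrow> nat) \<Rightarrow> nat" where
  "kendall_tau n \<pi> \<sigma> =
     card {(i, j). i \<in> {1..n} \<and> j \<in> {1..n} \<and> i < j \<and>
                   (inv \<pi> i < inv \<pi> j) \<noteq> (inv \<sigma> i < inv \<sigma> j)}"

definition mallows_density :: "nat \<Rightarrow> real \<Rightarrow> (nat \<Rightarrow> nat) \<Rightarrow> (nat \<Rightarrow> nat) \<Rightarrow> real" where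
  "mallows_density n \<phi> \<pi>\<^sub>0 \<pi> =
     (if \<pi> permutes {1..n}
      then \<phi> ^ kendall_tau n \<pi> \<pi>\<^sub>0 / (\<Sum>\<pi>' | \<pi>' permutes {1..n}. \<phi> ^ kendall_tau n \<pi>' \<pi>\<^sub>0)
      else 0)"

definition mallows :: "nat \<Rightarrow> real \<Rightarrow> (nat \<Rightarrow> nat) \<Rightarrow> (nat \<Rightarrow> nat) pmf" where
  "mallows n \<phi> \<pi>\<^sub>0 = embed_pmf (mallows_density n \<phi> \<pi>\<^sub>0)"

definition position_vector :: "(nat \<Rightarrow> nat) \<Rightarrow> nat \<Rightarrow> real" where
  "position_vector \<pi> i = real (inv \<pi> i)"

definition tv_dist :: "'a pmf \<Rightarrow> 'a pmf \<Rightarrow> real" where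
  "tv_dist p q = (SUP A. \<bar>measure_pmf.prob p A - measure_pmf.prob q A\<bar>)"

text \<open>The following two facts show that \<open>mallows\<close> and \<open>tv_dist\<close> are well defined: \<open>embed_pmf\<close>
  is applied to a genuine probability mass function, and the supremum is over a bounded set.\<close>

lemma pmf_mallows:
  assumes "0 \<le> \<phi>" "\<pi>\<^sub>0 permutes {1..n}"
  shows "pmf (mallows n \<phi> \<pi>\<^sub>0) \<pi> = mallows_density n \<phi> \<pi>\<^sub>0 \<pi>"
proof -
  let ?P = "{\<pi>. \<pi> permutes {1..n}}"
  let ?w = "\<lambda>\<pi>. \<phi> ^ kendall_tau n \<pi> \<pi>\<^sub>0"
  have fin: "finite ?P"
    by (rule finite_permutations) simp
  have "kendall_tau n \<pi>\<^sub>0 \<pi>\<^sub>0 = 0"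
    by (simp add: kendall_tau_def)
  then have "0 < ?w \<pi>\<^sub>0"
    by simp
  with fin assms have pos: "0 < sum ?w ?P"
    by (intro sum_pos2[of _ \<pi>\<^sub>0]) auto
  have nonneg: "0 \<le> mallows_density n \<phi> \<pi>\<^sub>0 \<rho>" for \<rho>
    using assms pos by (simp add: mallows_density_def)
  have "(\<integral>\<^sup>+\<rho>. ennreal (mallows_density n \<phi> \<pi>\<^sub>0 \<rho>) \<partial>count_space UNIV) =
        (\<Sum>\<rho>\<in>?P. ennreal (mallows_density n \<phi> \<pi>\<^sub>0 \<rho>))"
    using fin by (intro nn_integral_count_space') (auto simp: mallows_density_def)
  also have "\<dots> = ennreal (\<Sum>\<rho>\<in>?P. mallows_density n \<phi> \<pi>\<^sub>0 \<rho>)"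
    using nonneg by (simp add: sum_ennreal)
  also have "(\<Sum>\<rho>\<in>?P. mallows_density n \<phi> \<pi>\<^sub>0 \<rho>) = (\<Sum>\<rho>\<in>?P. ?w \<rho> / sum ?w ?P)"
    by (intro sum.cong) (auto simp: mallows_density_def)
  also have "\<dots> = 1"
    using pos by (simp flip: sum_divide_distrib)
  finally show ?thesis
    unfolding mallows_def using nonneg by (intro pmf_embed_pmf) auto
qed

lemma bdd_above_tv_dist:
  "bdd_above (range (\<lambda>A. \<bar>measure_pmf.prob p A - measure_pmf.prob q A\<bar>))"
proof (rule bdd_aboveI2)
  fix A
  show "\<bar>measure_pmf.prob p A - measure_pmf.prob q A\<bar> \<le> 1"
    using measure_pmf.prob_le_1[of p A] measure_pmf.prob_le_1[of q A]
      measure_nonneg[of "measure_pmf p" A] measure_nonneg[of "measure_pmf q" A]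
    by linarith
qed

end

theory Submission
  imports Defs
begin

text \<open>
  Write \<open>p, q\<close> for the two Mallows densities and \<open>d, e\<close> for the Kendall-tau distances to the two
  centres. The normalizers agree, so Bernoulli's inequality gives
  \<open>(p - q)\<^sup>2 \<le> (1 - \<phi>) (p - q) (e - d) (p + q)\<close>, and Cauchy--Schwarz reduces the claim to bounding the
  sums of \<open>p (e - d)\<close> and \<open>q (d - e)\<close> by \<open>(1 - \<phi>) \<parallel>v - v'\<parallel>\<^sup>2\<close>. The first is the sum, over the pairs
  ordered differently by the two centres, of the bias of the random permutation towards the order
  of the first centre. Exchanging two elements at distance \<open>g\<close> in the centre changes \<open>d\<close> by at most
  \<open>2 g\<close>, so the bias is at most \<open>2 g (1 - \<phi>)\<close>; and the sum of \<open>g\<close> over all discordant pairs is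
  \<open>\<parallel>v - v'\<parallel>\<^sup>2 / 2\<close> (Spearman).
\<close>

section \<open>Discordant pairs and the Kendall-tau distance\<close>

text \<open>Pairs are ordered, unlike in \<open>kendall_tau\<close>: without the condition
  \<open>i < j\<close> on labels, a relabelling of the elements maps discordant pairs bijectively to
  discordant pairs. The price is a factor 2.\<close>

definition discordant :: "'a set \<Rightarrow> ('a \<Rightarrow> nat) \<Rightarrow> ('a \<Rightarrow> nat) \<Rightarrow> ('a \<times> 'a) set" where
  "discordant S a b = {(x, y) \<in> S \<times> S. (a x < a y) \<noteq> (b x < b y)}"

lemma finite_discordant [simp]: "finite S \<Longrightarrow> finite (discordant S a b)"
  unfolding discordant_def by (rule finite_subset[of _ "S \<times> S"]) auto

lemma discordant_subset: "discordant S a b \<subseteq> S \<times> S"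
  by (auto simp: discordant_def)

lemma card_discordant_triangle:
  assumes "finite S"
  shows "card (discordant S a c) \<le> card (discordant S a b) + card (discordant S b c)"
proof -
  have "discordant S a c \<subseteq> discordant S a b \<union> discordant S b c"
    by (auto simp: discordant_def)
  then have "card (discordant S a c) \<le> card (discordant S a b \<union> discordant S b c)"
    using assms by (intro card_mono) auto
  then show ?thesis
    using card_Un_le le_trans by blast
qed

lemma card_discordant_relabel:
  assumes "t permutes S"
  shows "card (discordant S (a \<circ> t) (b \<circ> t)) = card (discordant S a b)"
proof -
  have "bij_betw (map_prod t t) (discordant S (a \<circ> t) (b \<circ> t)) (discordant S a b)"
  proof (rule bij_betwI[where g = "map_prod (inv t) (inv t)"])
    show "map_prod t t \<in> discordant S (a \<circ> t) (b \<circ> t) \<rightarrow> discordant S a b"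
      using assms by (auto simp: discordant_def permutes_in_image)
    show "map_prod (inv t) (inv t) \<in> discordant S a b \<rightarrow> discordant S (a \<circ> t) (b \<circ> t)"
      using assms permutes_inv[OF assms]
      by (auto simp: discordant_def permutes_in_image permutes_inverses)
  qed (use assms in \<open>auto simp: permutes_inverses\<close>)
  then show ?thesis
    by (rule bij_betw_same_card)
qed

text \<open>Positions are injective, so there are no ties and discordance is symmetric in the pair:
  \<open>?D\<close> is the disjoint union of \<open>?U\<close> and its mirror image.\<close>

lemma card_discordant_inv:
  assumes "\<pi> permutes {1..n}" "\<sigma> permutes {1..n}"
  shows "card (discordant {1..n} (inv \<pi>) (inv \<sigma>)) = 2 * kendall_tau n \<pi> \<sigma>"
proof -
  let ?D = "discordant {1..n} (inv \<pi>) (inv \<sigma>)"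
  let ?U = "{(i, j). i \<in> {1..n} \<and> j \<in> {1..n} \<and> i < j \<and>
                   (inv \<pi> i < inv \<pi> j) \<noteq> (inv \<sigma> i < inv \<sigma> j)}"
  have inj: "inj (inv \<pi>)" "inj (inv \<sigma>)"
    using assms permutes_inv permutes_inj by blast+
  have flip: "inv \<pi> i < inv \<pi> j \<longleftrightarrow> \<not> inv \<pi> j < inv \<pi> i"
    "inv \<sigma> i < inv \<sigma> j \<longleftrightarrow> \<not> inv \<sigma> j < inv \<sigma> i" if "i \<noteq> j" for i j
    using that injD[OF inj(1), of i j] injD[OF inj(2), of i j] by (metis less_asym nat_neq_iff)+
  have D: "?D = ?U \<union> prod.swap ` ?U"
  proof (intro set_eqI iffI)
    fix z assume "z \<in> ?D"
    then obtain i j where z: "z = (i, j)" "i \<in> {1..n}" "j \<in> {1..n}"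
      "(inv \<pi> i < inv \<pi> j) \<noteq> (inv \<sigma> i < inv \<sigma> j)"
      by (auto simp: discordant_def)
    then have "i \<noteq> j" by auto
    show "z \<in> ?U \<union> prod.swap ` ?U"
    proof (cases "i < j")
      case True
      then show ?thesis using z by auto
    next
      case False
      then have "(j, i) \<in> ?U"
        using z \<open>i \<noteq> j\<close> flip[OF \<open>i \<noteq> j\<close>] by (simp; linarith)
      then have "prod.swap (j, i) \<in> prod.swap ` ?U" by (rule imageI)
      then show ?thesis using z by simp
    qed
  next
    fix z assume "z \<in> ?U \<union> prod.swap ` ?U"
    then consider "z \<in> ?U" | i j where "z = (j, i)" "(i, j) \<in> ?U"
      by auto
    then show "z \<in> ?D"
    proof cases
      case 1
      then show ?thesis by (auto simp: discordant_def)
    next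
      case (2 i j)
      then have "i \<noteq> j" by auto
      then show ?thesis using 2 flip[of i j] by (auto simp: discordant_def)
    qed
  qed
  have fin: "finite ?U"
    by (rule finite_subset[of _ "{1..n} \<times> {1..n}"]) auto
  have "card ?D = card ?U + card (prod.swap ` ?U)"
    unfolding D using fin by (intro card_Un_disjoint) auto
  also have "card (prod.swap ` ?U) = card ?U"
    by (intro card_image) simp
  finally show ?thesis
    by (simp add: kendall_tau_def)
qed

lemma kendall_tau_triangle:
  assumes "\<pi> permutes {1..n}" "\<rho> permutes {1..n}" "\<sigma> permutes {1..n}"
  shows "kendall_tau n \<pi> \<sigma> \<le> kendall_tau n \<pi> \<rho> + kendall_tau n \<rho> \<sigma>"
  using card_discordant_triangle[of "{1..n}" "inv \<pi>" "inv \<sigma>" "inv \<rho>"] assms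
  by (simp add: card_discordant_inv del: One_nat_def)

text \<open>\<open>t \<circ> \<pi>\<close> renames the elements and keeps the positions, so
  \<open>inv t\<close> carries the pairs of one count to those of the other.\<close>

lemma kendall_tau_relabel:
  assumes "t permutes {1..n}" "\<pi> permutes {1..n}" "\<sigma> permutes {1..n}"
  shows "kendall_tau n (t \<circ> \<pi>) (t \<circ> \<sigma>) = kendall_tau n \<pi> \<sigma>"
proof -
  have "inv (t \<circ> \<pi>) = inv \<pi> \<circ> inv t" "inv (t \<circ> \<sigma>) = inv \<sigma> \<circ> inv t"
    using assms by (auto intro!: o_inv_distrib permutes_bij)
  then have "card (discordant {1..n} (inv (t \<circ> \<pi>)) (inv (t \<circ> \<sigma>)))
      = card (discordant {1..n} (inv \<pi>) (inv \<sigma>))"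
    using card_discordant_relabel[OF permutes_inv[OF assms(1)]] by simp
  then show ?thesis
    using assms by (simp add: card_discordant_inv permutes_compose del: One_nat_def)
qed

section \<open>Exchanging two elements\<close>

lemma inv_transpose_comp:
  assumes "\<pi> permutes {1..n}"
  shows "inv (Transposition.transpose i j \<circ> \<pi>) = inv \<pi> \<circ> Transposition.transpose i j"
  using assms by (subst o_inv_distrib) (auto intro: permutes_bij)

lemma card_preimage_le:
  assumes "inj a" "finite B"
  shows "card {y. a y \<in> B} \<le> card B"
proof -
  have "card {y. a y \<in> B} = card (a ` {y. a y \<in> B})"
    using assms by (intro card_image[symmetric]) (auto intro: inj_on_subset)
  also have "\<dots> \<le> card B"
    using assms by (intro card_mono) auto
  finally show ?thesis .
qed

text \<open>Only pairs containing \<open>i\<close> or \<open>j\<close> can change their order, and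
  only if the other element has a position from \<open>a i\<close> to \<open>a j\<close>.
  \<open>X\<close> and \<open>Y\<close> collect these pairs with \<open>i\<close> and
  \<open>j\<close> in front; each has at most \<open>a j - a i\<close> members, and both orders of a
  pair count, hence the 4.\<close>

lemma card_discordant_transpose_le:
  fixes a :: "'a \<Rightarrow> nat"
  assumes "inj a" "a i < a j"
  shows "card (discordant S a (a \<circ> Transposition.transpose i j)) \<le> 4 * (a j - a i)"
proof -
  define X where "X = Pair i ` {y. a y \<in> {a i<..a j}}"
  define Y where "Y = Pair j ` {y. a y \<in> {a i..<a j}}"
  have fin: "finite X" "finite Y"
    unfolding X_def Y_def using assms(1)
    by (intro finite_imageI finite_vimageI[unfolded vimage_def]; simp)+
  have X: "card X \<le> a j - a i" and Y: "card Y \<le> a j - a i"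
    unfolding X_def Y_def
    using card_preimage_le[OF assms(1), of "{a i<..a j}"]
      card_preimage_le[OF assms(1), of "{a i..<a j}"]
    by (auto simp: card_image inj_on_def)
  have "discordant S a (a \<circ> Transposition.transpose i j) \<subseteq> (X \<union> Y) \<union> prod.swap ` (X \<union> Y)"
  proof
    fix z assume "z \<in> discordant S a (a \<circ> Transposition.transpose i j)"
    then obtain x y where z: "z = (x, y)"
      and d: "(a x < a y) \<noteq> (a (Transposition.transpose i j x) < a (Transposition.transpose i j y))"
      by (auto simp: discordant_def)
    have inj: "a u = a v \<longleftrightarrow> u = v" for u v
      using assms(1) by (auto dest: injD)
    have "(x, y) \<in> X \<union> Y \<or> (y, x) \<in> X \<union> Y"
      using d assms(2) inj[of x y] inj[of x i] inj[of x j] inj[of y i] inj[of y j]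
      unfolding X_def Y_def image_iff Transposition.transpose_def
      by (auto split: if_splits)
    then show "z \<in> (X \<union> Y) \<union> prod.swap ` (X \<union> Y)"
      unfolding z by (metis UnI1 UnI2 imageI swap_simp)
  qed
  then have "card (discordant S a (a \<circ> Transposition.transpose i j)) \<le> card ((X \<union> Y) \<union> prod.swap ` (X \<union> Y))"
    using fin by (intro card_mono) auto
  also have "\<dots> \<le> card (X \<union> Y) + card (prod.swap ` (X \<union> Y))"
    by (rule card_Un_le)
  also have "\<dots> = 2 * card (X \<union> Y)"
    by (simp add: card_image)
  also have "\<dots> \<le> 4 * (a j - a i)"
    using X Y card_Un_le[of X Y] by simp
  finally show ?thesis .
qed

lemma kendall_tau_transpose_le:
  assumes "\<pi> permutes {1..n}" "i \<in> {1..n}" "j \<in> {1..n}" "i \<noteq> j"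
  shows "kendall_tau n \<pi> (Transposition.transpose i j \<circ> \<pi>) \<le> 2 * nat \<bar>int (inv \<pi> i) - int (inv \<pi> j)\<bar>"
proof -
  have t: "Transposition.transpose i j \<circ> \<pi> permutes {1..n}"
    using assms by (intro permutes_compose permutes_swap_id)
  have inj: "inj (inv \<pi>)"
    using assms permutes_inv permutes_inj by blast
  have ne: "inv \<pi> i \<noteq> inv \<pi> j"
    using inj assms by (auto dest: injD)
  have eq: "2 * kendall_tau n \<pi> (Transposition.transpose i j \<circ> \<pi>)
          = card (discordant {1..n} (inv \<pi>) (inv \<pi> \<circ> Transposition.transpose i j))"
    using card_discordant_inv[OF assms(1) t] inv_transpose_comp[OF assms(1)] by simp
  show ?thesis
  proof (cases "inv \<pi> i < inv \<pi> j")
    case True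
    then show ?thesis
      using card_discordant_transpose_le[OF inj True, of "{1..n}"] eq by linarith
  next
    case False
    with ne have "inv \<pi> j < inv \<pi> i" by simp
    then show ?thesis
      using card_discordant_transpose_le[OF inj, of j i "{1..n}"] eq
      by (simp add: Transposition.transpose_commute[of j i])
  qed
qed

text \<open>Relabelling by the involution \<open>?t\<close> moves the exchange from \<rho> to the
  centre, and the triangle inequality then passes through \<pi>. The increase thus depends on the
  gap in the centre and is uniform in \<rho>.\<close>

lemma kendall_tau_transpose_left_le:
  assumes "\<pi> permutes {1..n}" "\<rho> permutes {1..n}" "i \<in> {1..n}" "j \<in> {1..n}" "i \<noteq> j"
  shows "kendall_tau n (Transposition.transpose i j \<circ> \<rho>) \<pi>
           \<le> kendall_tau n \<rho> \<pi> + 2 * nat \<bar>int (inv \<pi> i) - int (inv \<pi> j)\<bar>"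
proof -
  let ?t = "Transposition.transpose i j"
  have t: "?t permutes {1..n}" "?t \<circ> \<pi> permutes {1..n}"
    using assms by (auto intro!: permutes_compose permutes_swap_id)
  have "?t \<circ> (?t \<circ> \<pi>) = \<pi>"
    by (simp add: fun_eq_iff)
  then have "kendall_tau n (?t \<circ> \<rho>) \<pi> = kendall_tau n \<rho> (?t \<circ> \<pi>)"
    using kendall_tau_relabel[OF t(1) assms(2) t(2)] by simp
  also have "\<dots> \<le> kendall_tau n \<rho> \<pi> + kendall_tau n \<pi> (?t \<circ> \<pi>)"
    using assms t by (intro kendall_tau_triangle)
  finally show ?thesis
    using kendall_tau_transpose_le[OF assms(1,3,4,5)] by linarith
qed

section \<open>Bias towards the order of the centre\<close>

lemma one_minus_power_le:
  fixes \<phi> :: real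
  assumes "0 \<le> \<phi>" "\<phi> \<le> 1"
  shows "1 - \<phi> ^ m \<le> real m * (1 - \<phi>)"
  using Bernoulli_inequality[of "\<phi> - 1" m] assms by (simp add: algebra_simps)

text \<open>Exchanging \<open>i\<close> and \<open>j\<close> maps the permutations that agree with
  \<pi> on this pair bijectively to those that do not, and shrinks each weight by at most the factor
  \<open>\<phi> ^ g\<close>. So the two total weights differ by at most
  \<open>1 - \<phi> ^ g\<close> times the first, and Bernoulli makes this linear in the gap.\<close>

lemma order_bias_le:
  fixes \<phi> :: real
  assumes "0 \<le> \<phi>" "\<phi> \<le> 1" "\<pi> permutes {1..n}" "i \<in> {1..n}" "j \<in> {1..n}" "i \<noteq> j"
  shows "(\<Sum>\<rho> | \<rho> permutes {1..n}. \<phi> ^ kendall_tau n \<rho> \<pi> *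
            (if (inv \<rho> i < inv \<rho> j) = (inv \<pi> i < inv \<pi> j) then 1 else -1))
         \<le> 2 * \<bar>real (inv \<pi> i) - real (inv \<pi> j)\<bar> * (1 - \<phi>) *
             (\<Sum>\<rho> | \<rho> permutes {1..n}. \<phi> ^ kendall_tau n \<rho> \<pi>)"
proof -
  let ?P = "{\<rho>. \<rho> permutes {1..n}}"
  let ?w = "\<lambda>\<rho>. \<phi> ^ kendall_tau n \<rho> \<pi>"
  let ?c = "\<lambda>\<rho>. (inv \<rho> i < inv \<rho> j) = (inv \<pi> i < inv \<pi> j)"
  let ?A = "{\<rho>\<in>?P. ?c \<rho>}" and ?B = "{\<rho>\<in>?P. \<not> ?c \<rho>}"
  let ?t = "Transposition.transpose i j"
  define g where "g = 2 * nat \<bar>int (inv \<pi> i) - int (inv \<pi> j)\<bar>"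
  have g: "real g = 2 * \<bar>real (inv \<pi> i) - real (inv \<pi> j)\<bar>"
    unfolding g_def by simp
  have fin: "finite ?P"
    by (rule finite_permutations) simp
  have perm: "?t \<circ> \<rho> \<in> ?P" if "\<rho> \<in> ?P" for \<rho>
    using that assms by (auto intro!: permutes_compose permutes_swap_id)
  have flip: "?c (?t \<circ> \<rho>) \<longleftrightarrow> \<not> ?c \<rho>" if "\<rho> \<in> ?P" for \<rho>
  proof -
    have "inv \<rho> i \<noteq> inv \<rho> j"
      using that \<open>i \<noteq> j\<close> by (metis mem_Collect_eq permutes_inverses(1))
    then show ?thesis
      using that by (auto simp: inv_transpose_comp)
  qed
  have tt: "?t \<circ> (?t \<circ> \<rho>) = \<rho>" for \<rho> :: "nat \<Rightarrow> nat"
    by (simp add: fun_eq_iff)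
  have "\<phi> ^ g * sum ?w ?A = (\<Sum>\<rho>\<in>?A. \<phi> ^ (kendall_tau n \<rho> \<pi> + g))"
    by (simp add: sum_distrib_left power_add mult.commute)
  \<comment> \<open>Powers of \<phi> decrease in the exponent, and the exchange adds at most
    \<open>g\<close> to the distance.\<close>
  also have "\<dots> \<le> (\<Sum>\<rho>\<in>?A. ?w (?t \<circ> \<rho>))"
    using kendall_tau_transpose_left_le[OF assms(3) _ assms(4-6)] assms
    unfolding g_def by (intro sum_mono power_decreasing) auto
  also have "\<dots> = sum ?w ?B"
    using perm flip tt
    by (intro sum.reindex_bij_witness[of _ "\<lambda>\<rho>. ?t \<circ> \<rho>" "\<lambda>\<rho>. ?t \<circ> \<rho>"]) blast+
  finally have B: "\<phi> ^ g * sum ?w ?A \<le> sum ?w ?B" .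
  have "(\<Sum>\<rho>\<in>?P. ?w \<rho> * (if ?c \<rho> then 1 else -1)) = (\<Sum>\<rho>\<in>?P. if ?c \<rho> then ?w \<rho> else - ?w \<rho>)"
    by (intro sum.cong) auto
  also have "\<dots> = sum ?w ?A - sum ?w ?B"
    using fin by (subst sum.If_cases) (auto simp: sum_negf Int_def)
  also have "\<dots> \<le> (1 - \<phi> ^ g) * sum ?w ?A"
    using B by (simp add: algebra_simps)
  also have "\<dots> \<le> (real g * (1 - \<phi>)) * sum ?w ?P"
    using assms fin one_minus_power_le[of \<phi> g]
    by (intro mult_mono sum_mono2 sum_nonneg) auto
  finally show ?thesis
    unfolding g by simp
qed

section \<open>Distance differences and position gaps over discordant pairs\<close>

text \<open>Pairs on which the two centres agree cancel; on any other pair \<rho> sides with exactly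
  one centre, giving 1 for \<pi> and -1 for \<sigma>. The factor 2 comes from counting ordered
  pairs.\<close>

lemma kendall_tau_diff:
  assumes "\<pi> permutes {1..n}" "\<sigma> permutes {1..n}" "\<rho> permutes {1..n}"
  shows "2 * (real (kendall_tau n \<rho> \<sigma>) - real (kendall_tau n \<rho> \<pi>)) =
    (\<Sum>(i, j)\<in>discordant {1..n} (inv \<pi>) (inv \<sigma>).
        if (inv \<rho> i < inv \<rho> j) = (inv \<pi> i < inv \<pi> j) then 1 else -1)"
proof -
  let ?S = "{1..n} \<times> {1..n}"
  have card: "2 * real (kendall_tau n \<rho> \<tau>)
      = (\<Sum>(i, j)\<in>?S. of_bool ((inv \<rho> i < inv \<rho> j) \<noteq> (inv \<tau> i < inv \<tau> j)))"
    if "\<tau> permutes {1..n}" for \<tau>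
  proof -
    have "2 * real (kendall_tau n \<rho> \<tau>) = real (card (discordant {1..n} (inv \<rho>) (inv \<tau>)))"
      using card_discordant_inv[OF assms(3) that] by simp
    also have "\<dots> = (\<Sum>z\<in>?S. of_bool (z \<in> discordant {1..n} (inv \<rho>) (inv \<tau>)))"
      by (simp add: of_bool_def sum.If_cases Int_absorb1 discordant_subset del: One_nat_def)
    also have "\<dots> = (\<Sum>(i, j)\<in>?S. of_bool ((inv \<rho> i < inv \<rho> j) \<noteq> (inv \<tau> i < inv \<tau> j)))"
      by (intro sum.cong) (auto simp: discordant_def)
    finally show ?thesis .
  qed
  have "2 * (real (kendall_tau n \<rho> \<sigma>) - real (kendall_tau n \<rho> \<pi>)) =
    (\<Sum>(i, j)\<in>?S. of_bool ((inv \<rho> i < inv \<rho> j) \<noteq> (inv \<sigma> i < inv \<sigma> j))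
       - of_bool ((inv \<rho> i < inv \<rho> j) \<noteq> (inv \<pi> i < inv \<pi> j)))"
    using card[OF assms(1)] card[OF assms(2)]
    by (simp add: right_diff_distrib case_prod_unfold sum_subtractf)
  also have "\<dots> = (\<Sum>(i, j)\<in>discordant {1..n} (inv \<pi>) (inv \<sigma>).
        if (inv \<rho> i < inv \<rho> j) = (inv \<pi> i < inv \<pi> j) then 1 else -1)"
    by (rule sum.mono_neutral_cong_right) (auto simp: discordant_def of_bool_def split: if_splits)
  finally show ?thesis .
qed

text \<open>After reindexing by positions, the \<open>b x - 1\<close> smaller positions contribute 1
  each, the \<open>n - b x\<close> larger ones -1, and \<open>b x\<close> itself contributes
  \<open>sgn 0 = 0\<close>.\<close>

lemma sum_sgn_positions:
  assumes "b permutes {1..n}" "x \<in> {1..n}"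
  shows "(\<Sum>y\<in>{1..n}. sgn (real (b x) - real (b y))) = 2 * real (b x) - real n - 1"
proof -
  have bx: "b x \<in> {1..n}"
    using assms permutes_in_image by metis
  have "(\<Sum>y\<in>{1..n}. sgn (real (b x) - real (b y))) = (\<Sum>k\<in>{1..n}. sgn (real (b x) - real k))"
    using sum.permute[OF assms(1), of "\<lambda>k. sgn (real (b x) - real k)"] by (simp add: comp_def)
  also have "\<dots> = (\<Sum>k\<in>insert (b x) ({1..<b x} \<union> {b x<..n}). sgn (real (b x) - real k))"
    using bx by (intro sum.cong) auto
  also have "\<dots> = (\<Sum>k\<in>{1..<b x} \<union> {b x<..n}. sgn (real (b x) - real k))"
    by simp
  also have "\<dots> = (\<Sum>k\<in>{1..<b x}. sgn (real (b x) - real k)) + (\<Sum>k\<in>{b x<..n}. sgn (real (b x) - real k))"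
    by (intro sum.union_disjoint) auto
  also have "\<dots> = (\<Sum>k\<in>{1..<b x}. 1) + (\<Sum>k\<in>{b x<..n}. -1)"
    by (intro arg_cong2[where f = "(+)"] sum.cong) auto
  finally show ?thesis
    using bx by (simp add: of_nat_diff)
qed

text \<open>The sum over \<open>x, y\<close> of \<open>(a x - a y) * sgn (c x - c y)\<close> is computed for \<open>c = a\<close> and for \<open>c = b\<close>;
  the two summands cancel on concordant pairs and differ by \<open>2 * \<bar>a x - a y\<bar>\<close> on discordant ones.\<close>

lemma sum_gap_discordant:
  assumes a: "a permutes {1..n}" and b: "b permutes {1..n}"
  shows "(\<Sum>(x, y)\<in>discordant {1..n} a b. \<bar>real (a x) - real (a y)\<bar>)
           = (\<Sum>x\<in>{1..n}. (real (a x) - real (b x))\<^sup>2)"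
proof -
  let ?S = "{1..n}"
  have sgn_sum: "(\<Sum>x\<in>?S. \<Sum>y\<in>?S. (real (a x) - real (a y)) * sgn (real (c x) - real (c y)))
      = 2 * (\<Sum>x\<in>?S. real (a x) * (2 * real (c x) - real n - 1))" if c: "c permutes ?S" for c
  proof -
    have 1: "(\<Sum>x\<in>?S. \<Sum>y\<in>?S. real (a x) * sgn (real (c x) - real (c y)))
        = (\<Sum>x\<in>?S. real (a x) * (2 * real (c x) - real n - 1))"
      using sum_sgn_positions[OF c] by (intro sum.cong) (auto simp flip: sum_distrib_left)
    \<comment> \<open>Renaming the variables and the oddness of \<open>sgn\<close> turn the
      \<open>a y\<close> half into minus the \<open>a x\<close> half, whence the factor 2 in
      \<open>sgn_sum\<close>.\<close>
    have "(\<Sum>x\<in>?S. \<Sum>y\<in>?S. real (a y) * sgn (real (c x) - real (c y)))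
        = (\<Sum>y\<in>?S. \<Sum>x\<in>?S. real (a y) * sgn (real (c x) - real (c y)))"
      by (rule sum.swap)
    also have "\<dots> = (\<Sum>y\<in>?S. \<Sum>x\<in>?S. - (real (a y) * sgn (real (c y) - real (c x))))"
      by (intro sum.cong refl) (auto simp: sgn_if)
    finally have 2: "(\<Sum>x\<in>?S. \<Sum>y\<in>?S. real (a y) * sgn (real (c x) - real (c y)))
        = - (\<Sum>x\<in>?S. \<Sum>y\<in>?S. real (a x) * sgn (real (c x) - real (c y)))"
      by (simp add: sum_negf)
    show ?thesis
      using 1 2 by (simp add: left_diff_distrib sum_subtractf)
  qed
  have inj: "a x = a y \<longleftrightarrow> x = y" "b x = b y \<longleftrightarrow> x = y" for x y
    using permutes_inj[OF a] permutes_inj[OF b] by (auto dest: injD)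
  have "2 * (\<Sum>(x, y)\<in>discordant ?S a b. \<bar>real (a x) - real (a y)\<bar>)
      = (\<Sum>(x, y)\<in>discordant ?S a b. 2 * \<bar>real (a x) - real (a y)\<bar>)"
    by (simp add: sum_distrib_left case_prod_unfold)
  also have "\<dots> = (\<Sum>(x, y)\<in>?S \<times> ?S. (real (a x) - real (a y)) * sgn (real (a x) - real (a y))
      - (real (a x) - real (a y)) * sgn (real (b x) - real (b y)))"
  proof (rule sum.mono_neutral_cong_left)
    show "\<forall>z\<in>?S \<times> ?S - discordant ?S a b. (case z of (x, y) \<Rightarrow>
        (real (a x) - real (a y)) * sgn (real (a x) - real (a y))
      - (real (a x) - real (a y)) * sgn (real (b x) - real (b y))) = 0"
    proof clarify
      fix x y assume "x \<in> ?S" "y \<in> ?S" "(x, y) \<notin> discordant ?S a b"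
      then have "(a x < a y) = (b x < b y)" by (simp add: discordant_def)
      then show "(real (a x) - real (a y)) * sgn (real (a x) - real (a y))
        - (real (a x) - real (a y)) * sgn (real (b x) - real (b y)) = 0"
        using inj[of x y] by (auto simp: sgn_if)
    qed
    fix z assume "z \<in> discordant ?S a b"
    then obtain x y where z: "z = (x, y)" and d: "(a x < a y) \<noteq> (b x < b y)"
      by (auto simp: discordant_def)
    then show "(case z of (x, y) \<Rightarrow> 2 * \<bar>real (a x) - real (a y)\<bar>) = (case z of (x, y) \<Rightarrow>
        (real (a x) - real (a y)) * sgn (real (a x) - real (a y))
      - (real (a x) - real (a y)) * sgn (real (b x) - real (b y)))"
      using inj[of x y] by (auto simp: sgn_if abs_if)
  qed (auto simp: discordant_def)
  also have "\<dots> = 2 * (\<Sum>x\<in>?S. real (a x) * (2 * real (a x) - real n - 1))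
      - 2 * (\<Sum>x\<in>?S. real (a x) * (2 * real (b x) - real n - 1))"
    unfolding sgn_sum[OF a, symmetric] sgn_sum[OF b, symmetric]
    by (simp add: sum.cartesian_product case_prod_unfold sum_subtractf)
  also have "\<dots> = 2 * (\<Sum>x\<in>?S. 2 * (real (a x))\<^sup>2 - 2 * real (a x) * real (b x))"
    unfolding right_diff_distrib[symmetric] sum_subtractf[symmetric]
    by (intro arg_cong2[where f = "(*)"] sum.cong) (auto simp: power2_eq_square algebra_simps)
  also have "\<dots> = 2 * ((\<Sum>x\<in>?S. (real (a x))\<^sup>2) + (\<Sum>x\<in>?S. (real (a x))\<^sup>2)
      - (\<Sum>x\<in>?S. 2 * real (a x) * real (b x)))"
    by (simp add: sum_subtractf sum_distrib_left)
  also have "(\<Sum>x\<in>?S. (real (a x))\<^sup>2) + (\<Sum>x\<in>?S. (real (a x))\<^sup>2)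
      = (\<Sum>x\<in>?S. (real (a x))\<^sup>2) + (\<Sum>x\<in>?S. (real (b x))\<^sup>2)"
    using sum.permute[OF a, of "\<lambda>k. (real k)\<^sup>2"] sum.permute[OF b, of "\<lambda>k. (real k)\<^sup>2"]
    by (simp add: comp_def)
  finally show ?thesis
    by (simp add: power2_diff sum.distrib sum_subtractf)
qed

text \<open>After exchanging sums, twice the left side is the sum of the order biases over all
  ordered discordant pairs. The 2 in \<open>order_bias_le\<close> absorbs the doubling, and
  \<open>sum_gap_discordant\<close>, applied to the inverse permutations, evaluates the remaining
  sum of gaps.\<close>

lemma sum_weighted_kendall_tau_diff_le:
  fixes \<phi> :: real
  assumes "0 \<le> \<phi>" "\<phi> \<le> 1" "\<pi> permutes {1..n}" "\<sigma> permutes {1..n}"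
  shows "(\<Sum>\<rho> | \<rho> permutes {1..n}. \<phi> ^ kendall_tau n \<rho> \<pi> *
            (real (kendall_tau n \<rho> \<sigma>) - real (kendall_tau n \<rho> \<pi>)))
         \<le> (1 - \<phi>) * (\<Sum>i\<in>{1..n}. (real (inv \<pi> i) - real (inv \<sigma> i))\<^sup>2) *
             (\<Sum>\<rho> | \<rho> permutes {1..n}. \<phi> ^ kendall_tau n \<rho> \<pi>)"
proof -
  let ?P = "{\<rho>. \<rho> permutes {1..n}}"
  let ?w = "\<lambda>\<rho>. \<phi> ^ kendall_tau n \<rho> \<pi>"
  let ?D = "discordant {1..n} (inv \<pi>) (inv \<sigma>)"
  let ?s = "\<lambda>\<rho> z. if (inv \<rho> (fst z) < inv \<rho> (snd z)) = (inv \<pi> (fst z) < inv \<pi> (snd z)) then 1 else -1 :: real"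
  have "2 * (\<Sum>\<rho>\<in>?P. ?w \<rho> * (real (kendall_tau n \<rho> \<sigma>) - real (kendall_tau n \<rho> \<pi>)))
      = (\<Sum>\<rho>\<in>?P. ?w \<rho> * (2 * (real (kendall_tau n \<rho> \<sigma>) - real (kendall_tau n \<rho> \<pi>))))"
    unfolding sum_distrib_left by (intro sum.cong) auto
  also have "\<dots> = (\<Sum>\<rho>\<in>?P. \<Sum>z\<in>?D. ?w \<rho> * ?s \<rho> z)"
    using kendall_tau_diff[OF assms(3,4)]
    by (intro sum.cong refl) (simp add: case_prod_unfold sum_distrib_left)
  also have "\<dots> = (\<Sum>z\<in>?D. \<Sum>\<rho>\<in>?P. ?w \<rho> * ?s \<rho> z)"
    by (rule sum.swap)
  also have "\<dots> \<le> (\<Sum>z\<in>?D. 2 * \<bar>real (inv \<pi> (fst z)) - real (inv \<pi> (snd z))\<bar> * (1 - \<phi>) * sum ?w ?P)"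
    by (intro sum_mono order_bias_le assms) (auto simp: discordant_def)
  also have "\<dots> = 2 * ((1 - \<phi>) * (\<Sum>(i, j)\<in>?D. \<bar>real (inv \<pi> i) - real (inv \<pi> j)\<bar>) * sum ?w ?P)"
    by (simp add: case_prod_unfold sum_distrib_left sum_distrib_right mult_ac)
  finally show ?thesis
    using sum_gap_discordant[OF permutes_inv[OF assms(3)] permutes_inv[OF assms(4)]] by simp
qed

section \<open>Normalizers and the pointwise estimate\<close>

text \<open>Left composition with \<open>\<sigma> \<circ> inv \<pi>\<close> permutes the
  permutations, sends \<pi> to \<sigma> and preserves distances.\<close>

lemma mallows_normalizer_eq:
  fixes \<phi> :: real
  assumes "\<pi> permutes {1..n}" "\<sigma> permutes {1..n}"
  shows "(\<Sum>\<rho> | \<rho> permutes {1..n}. \<phi> ^ kendall_tau n \<rho> \<pi>)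
       = (\<Sum>\<rho> | \<rho> permutes {1..n}. \<phi> ^ kendall_tau n \<rho> \<sigma>)"
proof -
  let ?t = "\<sigma> \<circ> inv \<pi>"
  have t: "?t permutes {1..n}"
    using assms by (intro permutes_compose permutes_inv)
  have "?t \<circ> \<pi> = \<sigma>"
    using assms by (simp add: fun_eq_iff permutes_inverses)
  then have "kendall_tau n (?t \<circ> \<rho>) \<sigma> = kendall_tau n \<rho> \<pi>" if "\<rho> permutes {1..n}" for \<rho>
    using kendall_tau_relabel[OF t that assms(1)] by simp
  then show ?thesis
    using setum_permutations_compose_left[OF t, of "\<lambda>\<rho>. \<phi> ^ kendall_tau n \<rho> \<sigma>"] by simp
qed

text \<open>For \<open>k \<le> l\<close>, Bernoulli bounds \<open>\<phi> ^ k - \<phi> ^ l\<close> by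
  \<open>\<phi> ^ k * ((l - k) * (1 - \<phi>))\<close>; multiplying by the difference itself gives
  the square. The product form suits Cauchy--Schwarz: the last factor will sum to twice the
  normalizer, the rest is controlled by the order biases.\<close>

lemma power_diff_square_le:
  fixes \<phi> :: real
  assumes "0 \<le> \<phi>" "\<phi> \<le> 1"
  shows "(\<phi> ^ k - \<phi> ^ l)\<^sup>2 \<le> (1 - \<phi>) * ((\<phi> ^ k - \<phi> ^ l) * (real l - real k)) * (\<phi> ^ k + \<phi> ^ l)"
proof -
  have le: "(\<phi> ^ k - \<phi> ^ l)\<^sup>2 \<le> (1 - \<phi>) * ((\<phi> ^ k - \<phi> ^ l) * (real l - real k)) * (\<phi> ^ k + \<phi> ^ l)"
    if "k \<le> l" for k l
  proof -
    define m where "m = l - k"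
    have l: "l = k + m" using that by (simp add: m_def)
    have p: "0 \<le> \<phi> ^ k" "0 \<le> \<phi> ^ l" and d: "0 \<le> \<phi> ^ k - \<phi> ^ l"
      using assms that by (auto intro: power_decreasing)
    have "\<phi> ^ k - \<phi> ^ l = \<phi> ^ k * (1 - \<phi> ^ m)"
      by (simp add: l power_add algebra_simps)
    also have "\<dots> \<le> \<phi> ^ k * (real m * (1 - \<phi>))"
      using p one_minus_power_le[OF assms] by (intro mult_left_mono)
    \<comment> \<open>Adding \<open>\<phi> ^ l\<close> makes the bound symmetric in \<open>k\<close>
      and \<open>l\<close>, so that the case \<open>l < k\<close> follows by exchanging
      them.\<close>
    also have "\<dots> \<le> (\<phi> ^ k + \<phi> ^ l) * (real m * (1 - \<phi>))"
      using p assms by (intro mult_right_mono) auto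
    finally have "(\<phi> ^ k - \<phi> ^ l) * (\<phi> ^ k - \<phi> ^ l)
        \<le> (\<phi> ^ k - \<phi> ^ l) * ((\<phi> ^ k + \<phi> ^ l) * (real m * (1 - \<phi>)))"
      using d by (intro mult_left_mono)
    moreover have "real m = real l - real k"
      by (simp add: l)
    ultimately show ?thesis
      by (simp add: power2_eq_square mult_ac)
  qed
  show ?thesis
  proof (cases "k \<le> l")
    case True
    then show ?thesis by (rule le)
  next
    case False
    then show ?thesis
      using le[of l k] by (simp add: power2_commute[of "\<phi> ^ k"] algebra_simps)
  qed
qed

section \<open>Cauchy--Schwarz and total variation\<close>

text \<open>Cauchy--Schwarz for \<open>sqrt (f x)\<close> and \<open>sqrt (g x)\<close>, whose
  product dominates \<open>\<bar>d x\<bar>\<close>.\<close>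

lemma sum_abs_le_sqrt_sum_mult_sum:
  fixes d f g :: "'a \<Rightarrow> real"
  assumes "\<And>x. x \<in> P \<Longrightarrow> (d x)\<^sup>2 \<le> f x * g x"
    and "\<And>x. x \<in> P \<Longrightarrow> 0 \<le> f x" and "\<And>x. x \<in> P \<Longrightarrow> 0 \<le> g x"
  shows "(\<Sum>x\<in>P. \<bar>d x\<bar>) \<le> sqrt (sum f P * sum g P)"
proof -
  have "(\<Sum>x\<in>P. \<bar>d x\<bar>) \<le> (\<Sum>x\<in>P. \<bar>sqrt (f x)\<bar> * \<bar>sqrt (g x)\<bar>)"
    using assms by (intro sum_mono) (simp add: real_sqrt_le_mono flip: real_sqrt_abs real_sqrt_mult)
  also have "\<dots> \<le> L2_set (\<lambda>x. sqrt (f x)) P * L2_set (\<lambda>x. sqrt (g x)) P"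
    by (rule L2_set_mult_ineq)
  also have "\<dots> = sqrt (sum f P * sum g P)"
    using assms by (simp add: L2_set_def real_sqrt_mult)
  finally show ?thesis .
qed

text \<open>Both measures live on \<open>P\<close>, so each difference of probabilities is a sum of
  \<open>pmf p x - pmf q x\<close> over part of \<open>P\<close>. The full sum of absolute values is
  twice the total variation; the constant 2 of the final bound includes this loss.\<close>

lemma tv_dist_le_sum_abs:
  assumes "finite P" "set_pmf p \<subseteq> P" "set_pmf q \<subseteq> P"
  shows "tv_dist p q \<le> (\<Sum>x\<in>P. \<bar>pmf p x - pmf q x\<bar>)"
  unfolding tv_dist_def
proof (rule cSUP_least)
  fix A
  have prob: "measure_pmf.prob r A = sum (pmf r) (A \<inter> P)" if "set_pmf r \<subseteq> P" for r
  proof -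
    have "measure_pmf.prob r A = measure_pmf.prob r (A \<inter> P)"
      using that by (intro measure_prob_cong_0) (auto simp: pmf_eq_0_set_pmf)
    then show ?thesis
      using assms(1) by (simp add: measure_measure_pmf_finite)
  qed
  have "\<bar>measure_pmf.prob p A - measure_pmf.prob q A\<bar> = \<bar>\<Sum>x\<in>A \<inter> P. pmf p x - pmf q x\<bar>"
    using assms by (simp add: prob sum_subtractf)
  also have "\<dots> \<le> (\<Sum>x\<in>A \<inter> P. \<bar>pmf p x - pmf q x\<bar>)"
    by (rule sum_abs)
  also have "\<dots> \<le> (\<Sum>x\<in>P. \<bar>pmf p x - pmf q x\<bar>)"
    using assms by (intro sum_mono2) auto
  finally show "\<bar>measure_pmf.prob p A - measure_pmf.prob q A\<bar> \<le> (\<Sum>x\<in>P. \<bar>pmf p x - pmf q x\<bar>)" .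
qed simp

theorem theorem4p1:
  fixes n :: nat and \<phi> :: real and \<pi>\<^sub>0 \<sigma>\<^sub>0 :: "nat \<Rightarrow> nat"
  assumes "0 \<le> \<phi>" and "\<phi> \<le> 1"
    and "\<pi>\<^sub>0 permutes {1..n}" and "\<sigma>\<^sub>0 permutes {1..n}"
  shows "tv_dist (mallows n \<phi> \<pi>\<^sub>0) (mallows n \<phi> \<sigma>\<^sub>0)
           \<le> 2 * (1 - \<phi>) * L2_set (\<lambda>i. position_vector \<pi>\<^sub>0 i - position_vector \<sigma>\<^sub>0 i) {1..n}"
proof -
  let ?P = "{\<rho>. \<rho> permutes {1..n}}"
  let ?d = "\<lambda>\<tau> \<rho>. kendall_tau n \<rho> \<tau>"
  define Z where "Z = (\<Sum>\<rho>\<in>?P. \<phi> ^ ?d \<pi>\<^sub>0 \<rho>)"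
  have Z': "Z = (\<Sum>\<rho>\<in>?P. \<phi> ^ ?d \<sigma>\<^sub>0 \<rho>)"
    unfolding Z_def using assms by (intro mallows_normalizer_eq)
  define D where "D = (\<Sum>i\<in>{1..n}. (real (inv \<pi>\<^sub>0 i) - real (inv \<sigma>\<^sub>0 i))\<^sup>2)"
  \<comment> \<open>\<open>X\<close> and \<open>Y\<close> are the two factors in
    \<open>power_diff_square_le\<close>, built from unnormalized weights.\<close>
  define X where "X \<rho> = (1 - \<phi>) * ((\<phi> ^ ?d \<pi>\<^sub>0 \<rho> - \<phi> ^ ?d \<sigma>\<^sub>0 \<rho>) *
      (real (?d \<sigma>\<^sub>0 \<rho>) - real (?d \<pi>\<^sub>0 \<rho>)))" for \<rho>
  define Y where "Y \<rho> = \<phi> ^ ?d \<pi>\<^sub>0 \<rho> + \<phi> ^ ?d \<sigma>\<^sub>0 \<rho>" for \<rho>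
  have fin: "finite ?P"
    by (rule finite_permutations) simp
  \<comment> \<open>The centre is at distance 0 from itself and \<open>\<phi> ^ 0 = 1\<close> even
    for \<open>\<phi> = 0\<close>, so the normalizer never vanishes.\<close>
  have "0 < \<phi> ^ ?d \<pi>\<^sub>0 \<pi>\<^sub>0"
    by (simp add: kendall_tau_def)
  then have Z_pos: "0 < Z"
    unfolding Z_def using fin assms by (intro sum_pos2[of _ \<pi>\<^sub>0]) auto
  have sumY: "sum Y ?P = 2 * Z"
    unfolding Y_def using Z' by (simp add: sum.distrib Z_def)
  \<comment> \<open>The product splits into one sum per centre; both are bounded by the same lemma
    with the centres exchanged, which changes neither \<open>D\<close> nor \<open>Z\<close>.\<close>
  have "(\<Sum>\<rho>\<in>?P. (\<phi> ^ ?d \<pi>\<^sub>0 \<rho> - \<phi> ^ ?d \<sigma>\<^sub>0 \<rho>) * (real (?d \<sigma>\<^sub>0 \<rho>) - real (?d \<pi>\<^sub>0 \<rho>)))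
      = (\<Sum>\<rho>\<in>?P. \<phi> ^ ?d \<pi>\<^sub>0 \<rho> * (real (?d \<sigma>\<^sub>0 \<rho>) - real (?d \<pi>\<^sub>0 \<rho>)))
      + (\<Sum>\<rho>\<in>?P. \<phi> ^ ?d \<sigma>\<^sub>0 \<rho> * (real (?d \<pi>\<^sub>0 \<rho>) - real (?d \<sigma>\<^sub>0 \<rho>)))"
    unfolding sum.distrib[symmetric] by (intro sum.cong) (auto simp: algebra_simps)
  also have "\<dots> \<le> (1 - \<phi>) * D * Z + (1 - \<phi>) * D * Z"
    using sum_weighted_kendall_tau_diff_le[OF assms(1,2,3,4)]
      sum_weighted_kendall_tau_diff_le[OF assms(1,2,4,3)]
    unfolding Z_def[symmetric] Z'[symmetric] D_def
    by (intro add_mono) (simp_all add: power2_commute)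
  finally have sumX: "sum X ?P \<le> (1 - \<phi>) * (2 * ((1 - \<phi>) * D * Z))"
    unfolding X_def sum_distrib_left[symmetric] using assms by (intro mult_left_mono) (auto simp: mult_ac)
  \<comment> \<open>Powers of \<phi> decrease in the exponent, so the two differences in
    \<open>X\<close> never have opposite signs.\<close>
  have X_nonneg: "0 \<le> X \<rho>" for \<rho>
  proof (cases "?d \<pi>\<^sub>0 \<rho> \<le> ?d \<sigma>\<^sub>0 \<rho>")
    case True
    then show ?thesis
      unfolding X_def using assms by (intro mult_nonneg_nonneg) (auto intro: power_decreasing)
  next
    case False
    then show ?thesis
      unfolding X_def using assms
      by (intro mult_nonneg_nonneg mult_nonpos_nonpos) (auto intro: power_decreasing)
  qed
  have pmf: "pmf (mallows n \<phi> \<pi>\<^sub>0) \<rho> = \<phi> ^ ?d \<pi>\<^sub>0 \<rho> / Z" "pmf (mallows n \<phi> \<sigma>\<^sub>0) \<rho> = \<phi> ^ ?d \<sigma>\<^sub>0 \<rho> / Z"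
    if "\<rho> \<in> ?P" for \<rho>
    using that assms Z' by (auto simp: pmf_mallows mallows_density_def Z_def)
  have supp: "set_pmf (mallows n \<phi> \<tau>) \<subseteq> ?P" if "\<tau> permutes {1..n}" for \<tau>
    using that assms(1) by (auto simp: set_pmf_iff pmf_mallows mallows_density_def split: if_splits)
  have "tv_dist (mallows n \<phi> \<pi>\<^sub>0) (mallows n \<phi> \<sigma>\<^sub>0)
      \<le> (\<Sum>\<rho>\<in>?P. \<bar>pmf (mallows n \<phi> \<pi>\<^sub>0) \<rho> - pmf (mallows n \<phi> \<sigma>\<^sub>0) \<rho>\<bar>)"
    using fin supp assms by (intro tv_dist_le_sum_abs)
  also have "\<dots> = (\<Sum>\<rho>\<in>?P. \<bar>\<phi> ^ ?d \<pi>\<^sub>0 \<rho> - \<phi> ^ ?d \<sigma>\<^sub>0 \<rho>\<bar> / Z)"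
    using Z_pos by (intro sum.cong refl) (simp add: pmf flip: diff_divide_distrib)
  also have "\<dots> = (\<Sum>\<rho>\<in>?P. \<bar>\<phi> ^ ?d \<pi>\<^sub>0 \<rho> - \<phi> ^ ?d \<sigma>\<^sub>0 \<rho>\<bar>) / Z"
    by (simp add: sum_divide_distrib)
  also have "\<dots> \<le> sqrt (sum X ?P * sum Y ?P) / Z"
    using Z_pos X_nonneg power_diff_square_le[OF assms(1,2)] assms(1)
    by (intro divide_right_mono sum_abs_le_sqrt_sum_mult_sum) (auto simp: X_def Y_def)
  also have "\<dots> \<le> sqrt ((1 - \<phi>) * (2 * ((1 - \<phi>) * D * Z)) * (2 * Z)) / Z"
    using sumX Z_pos unfolding sumY
    by (intro divide_right_mono real_sqrt_le_mono mult_right_mono) auto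
  \<comment> \<open>One factor \<open>1 - \<phi>\<close> stems from the pointwise estimate and one
    from the order bias, so the root keeps a single one. The two factors \<open>Z\<close> come from
    \<open>sumX\<close> and \<open>sumY\<close>; their root cancels the denominator.\<close>
  also have "(1 - \<phi>) * (2 * ((1 - \<phi>) * D * Z)) * (2 * Z) = (2 * (1 - \<phi>) * Z)\<^sup>2 * D"
    by algebra
  also have "sqrt \<dots> / Z = 2 * (1 - \<phi>) * sqrt D"
    using Z_pos assms by (simp add: real_sqrt_mult)
  also have "sqrt D = L2_set (\<lambda>i. position_vector \<pi>\<^sub>0 i - position_vector \<sigma>\<^sub>0 i) {1..n}"
    by (simp add: D_def L2_set_def position_vector_def)
  finally show ?thesis .
qed

end
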